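(* Let $G$ be a supersoluble group. Then the group $\mathrm{Aut_n}(G)$ of all normal automorphisms of $G$ is finitely generated and nilpotent-by-(finite and supersoluble); that is, $\mathrm{Aut_n}(G)$ is finitely generated and has a nilpotent normal subgroup $N$ such that $\mathrm{Aut_n}(G)/N$ is finite and supersoluble.
   Context: An automorphism $\varphi$ of a group $G$ is called normal if $\varphi(H)=H$ for every normal subgroup $H$ of $G$. The normal automorphisms of $G$ form a normal subgroup $\mathrm{Aut_n}(G)$ of the automorphism group $\mathrm{Aut}(G)$. A (possibly infinite) group is supersoluble if it has a finite series $1=G_m\leq G_{m-1}\leq\cdots\leq G_0=G$ of subgroups, each normal in $G$, with every factor $G_k/G_{k+1}$ cyclic. *)

theory Defs
  imports "HOL-Algebra.Bij" "HOL-Algebra.Elementary_Groups" "HOL-Algebra.Generated_Groups"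
begin

definition normal_auto :: "('a, 'b) monoid_scheme \<Rightarrow> ('a \<Rightarrow> 'a) set"
  where "normal_auto G = {\<phi> \<in> auto G. \<forall>H. H \<lhd> G \<longrightarrow> \<phi> ` H = H}"

definition normal_AutoGroup :: "('a, 'b) monoid_scheme \<Rightarrow> ('a \<Rightarrow> 'a) monoid"
  where "normal_AutoGroup G = AutoGroup G \<lparr>carrier := normal_auto G\<rparr>"

(* Subgroups are carrier sets, so the factor H k / H (k+1) is formed in G restricted to H k. *)
definition supersoluble_group :: "('a, 'b) monoid_scheme \<Rightarrow> bool"
  where "supersoluble_group G \<longleftrightarrow> group G \<and>
    (\<exists>(m::nat) (H :: nat \<Rightarrow> 'a set).
       H 0 = carrier G \<and> H m = {\<one>\<^bsub>G\<^esub>} \<and>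
       (\<forall>k\<le>m. H k \<lhd> G) \<and>
       (\<forall>k<m. H (Suc k) \<subseteq> H k \<and> cyclic_group ((G\<lparr>carrier := H k\<rparr>) Mod H (Suc k))))"

definition finitely_generated_group :: "('a, 'b) monoid_scheme \<Rightarrow> bool"
  where "finitely_generated_group G \<longleftrightarrow> group G \<and>
    (\<exists>S. finite S \<and> S \<subseteq> carrier G \<and> generate G S = carrier G)"

primrec lower_central_series :: "('a, 'b) monoid_scheme \<Rightarrow> nat \<Rightarrow> 'a set"
  where
    "lower_central_series G 0 = carrier G"
  | "lower_central_series G (Suc n) =
       generate G {x \<otimes>\<^bsub>G\<^esub> y \<otimes>\<^bsub>G\<^esub> inv\<^bsub>G\<^esub> x \<otimes>\<^bsub>G\<^esub> inv\<^bsub>G\<^esub> y | x y.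
         x \<in> lower_central_series G n \<and> y \<in> carrier G}"

definition nilpotent_group :: "('a, 'b) monoid_scheme \<Rightarrow> bool"
  where "nilpotent_group G \<longleftrightarrow> group G \<and> (\<exists>n. lower_central_series G n = {\<one>\<^bsub>G\<^esub>})"

lemma (in group) normal_auto_normal: "normal_auto G \<lhd> AutoGroup G"
proof -
  let ?A = "AutoGroup G"
  interpret A: group ?A by (rule AutoGroup)
  have carr: "carrier ?A = auto G"
    and one: "\<one>\<^bsub>?A\<^esub> = (\<lambda>x\<in>carrier G. x)"
    by (simp_all add: AutoGroup_def BijGroup_def)
  have mult: "f \<otimes>\<^bsub>?A\<^esub> g = compose (carrier G) f g" if "f \<in> auto G" "g \<in> auto G" for f g
    using that by (simp add: AutoGroup_def BijGroup_def auto_def)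
  have sub: "H \<subseteq> carrier G" if "H \<lhd> G" for H
    using that normal_imp_subgroup subgroup.subset by blast
  have im: "(f \<otimes>\<^bsub>?A\<^esub> g) ` H = f ` (g ` H)"
    if "f \<in> auto G" "g \<in> auto G" "H \<subseteq> carrier G" for f g H
    using that by (force simp: mult compose_def image_iff)
  have one_im: "\<one>\<^bsub>?A\<^esub> ` H = H" if "H \<subseteq> carrier G" for H
    using that by (auto simp: one image_iff subset_iff)
  have inv: "inv\<^bsub>?A\<^esub> f \<in> auto G" if "f \<in> auto G" for f
    using A.inv_closed that by (simp add: carr)
  have inv_im: "(inv\<^bsub>?A\<^esub> f) ` (f ` H) = H" if "f \<in> auto G" "H \<subseteq> carrier G" for f H
    using im[OF inv[OF that(1)] that] A.l_inv[of f] that one_im by (simp add: carr)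
  have im_inv: "f ` ((inv\<^bsub>?A\<^esub> f) ` H) = H" if "f \<in> auto G" "H \<subseteq> carrier G" for f H
    using im[OF that(1) inv[OF that(1)] that(2)] A.r_inv[of f] that one_im by (simp add: carr)
  have maps: "f ` carrier G = carrier G" if "f \<in> auto G" for f
    using that by (auto simp: auto_def Bij_def bij_betw_def)
  have normal_im: "f ` H \<lhd> G" if f: "f \<in> auto G" and H: "H \<lhd> G" for f H
  proof -
    have hom: "f \<in> hom G G" using f by (simp add: auto_def)
    interpret h: group_hom G G f
      by (simp add: group_hom_def group_hom_axioms_def hom)
    interpret H: normal H G by (rule H)
    show ?thesis
    proof (rule normal_invI)
      show "subgroup (f ` H) G"
        by (rule h.subgroup_img_is_subgroup) (rule H.subgroup_axioms)
    next
      fix x h assume x: "x \<in> carrier G" and "h \<in> f ` H"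
      then obtain k where k: "k \<in> H" "h = f k" by blast
      from x maps[OF f] obtain y where y: "y \<in> carrier G" "x = f y" by blast
      have kc: "k \<in> carrier G" using k H.subset by blast
      have "x \<otimes> h \<otimes> inv x = f (y \<otimes> k \<otimes> inv y)"
        using k y kc by simp
      then show "x \<otimes> h \<otimes> inv x \<in> f ` H"
        using H.inv_op_closed2[OF y(1) k(1)] by blast
    qed
  qed
  have "subgroup (normal_auto G) ?A"
  proof
    show "normal_auto G \<subseteq> carrier ?A" by (auto simp: normal_auto_def carr)
    show "\<one>\<^bsub>?A\<^esub> \<in> normal_auto G"
      using one_im sub A.one_closed by (simp add: normal_auto_def carr)
    show "f \<otimes>\<^bsub>?A\<^esub> g \<in> normal_auto G" if "f \<in> normal_auto G" "g \<in> normal_auto G" for f g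
      using that A.m_closed[of f g] by (simp add: normal_auto_def carr im sub)
    show "inv\<^bsub>?A\<^esub> f \<in> normal_auto G" if "f \<in> normal_auto G" for f
    proof -
      have "(inv\<^bsub>?A\<^esub> f) ` H = H" if H: "H \<lhd> G" for H
        using inv_im[of f H] \<open>f \<in> normal_auto G\<close> H sub by (simp add: normal_auto_def)
      then show ?thesis using that inv by (simp add: normal_auto_def)
    qed
  qed
  then show ?thesis
  proof (rule A.normal_invI)
    fix f g assume f: "f \<in> carrier ?A" and g: "g \<in> normal_auto G"
    have fg: "f \<in> auto G" "g \<in> auto G" "inv\<^bsub>?A\<^esub> f \<in> auto G" "f \<otimes>\<^bsub>?A\<^esub> g \<in> auto G"
      using f g inv A.m_closed[of f g] by (simp_all add: carr normal_auto_def)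
    have "(f \<otimes>\<^bsub>?A\<^esub> g \<otimes>\<^bsub>?A\<^esub> inv\<^bsub>?A\<^esub> f) ` H = H" if H: "H \<lhd> G" for H
    proof -
      have K: "(inv\<^bsub>?A\<^esub> f) ` H \<lhd> G" using normal_im fg(3) H by blast
      then have "g ` ((inv\<^bsub>?A\<^esub> f) ` H) = (inv\<^bsub>?A\<^esub> f) ` H"
        using g by (simp add: normal_auto_def)
      then show ?thesis
        using im[OF fg(4) fg(3) sub[OF H]] im[OF fg(1) fg(2) sub[OF K]] im_inv[OF fg(1) sub[OF H]]
        by simp
    qed
    then show "f \<otimes>\<^bsub>?A\<^esub> g \<otimes>\<^bsub>?A\<^esub> inv\<^bsub>?A\<^esub> f \<in> normal_auto G"
      using A.m_closed[of "f \<otimes>\<^bsub>?A\<^esub> g" "inv\<^bsub>?A\<^esub> f"] fg by (simp add: normal_auto_def carr)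
  qed
qed

end

theory Submission
  imports Defs
begin

text \<open>
  Let \<open>G = H 0 \<supseteq> H 1 \<supseteq> \<dots> \<supseteq> H m = 1\<close> be a series of normal subgroups of \<open>G\<close> with cyclic factors. A
  normal automorphism maps every \<open>H k\<close> onto itself, so \<open>A = Aut\<^sub>n(G)\<close> acts on each factor
  \<open>H k / H (k + 1)\<close>. Let \<open>N\<close> be the stability group of the series, consisting of the elements of
  \<open>A\<close> that act trivially on every factor. It is the required subgroup, and this uses only that
  \<open>A\<close> acts faithfully by automorphisms that preserve the series; the locale
  \<open>cyclic_series_action\<close> isolates this situation.

  The quotient \<open>A / N\<close> embeds into the product of the groups \<open>Aut (H k / H (k + 1))\<close>. The
  automorphism group of a cyclic group is finite and abelian, hence so is \<open>A / N\<close>, and a finite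
  abelian group is supersoluble.

  Nilpotency of \<open>N\<close> comes from the subgroups \<open>F i\<close> (called \<open>shifting i\<close> below) of those \<open>\<phi>\<close>
  with \<open>\<phi> x \<in> H (k + i) x\<close> whenever \<open>x \<in> H k\<close>, the series being continued by \<open>1\<close>: here \<open>F 1 = N\<close>, \<open>F m = 1\<close>, and the lemma
  \<open>commutator_increases_shift\<close> gives \<open>[F i, N] \<subseteq> F (i + 1)\<close>.

  For finite generation of \<open>N\<close>, filter it instead by the subgroups \<open>N j\<close> of elements acting
  trivially on \<open>G / H j\<close>. For fixed \<open>g\<close> the map \<open>\<phi> \<mapsto> g\<^sup>-\<^sup>1 \<phi>(g)\<close> induces a homomorphism from
  \<open>N j\<close> to the cyclic group \<open>H j / H (j + 1)\<close>, because \<open>N\<close> acts trivially on this factor. As \<open>g\<close>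
  runs through a finite generating set of \<open>G\<close>, the common kernel of these homomorphisms is
  \<open>N (j + 1)\<close>. Thus \<open>N\<close> is built from the trivial group \<open>N m\<close> by finitely many extensions with
  cyclic quotient, each adding a single generator (\<open>finitely_generated_fixing_step\<close>). Finally
  \<open>A\<close> needs only finitely many further generators, as \<open>N\<close> has finite index.
\<close>

section \<open>Finite generation, cyclic factors and central filtrations\<close>

text \<open>
  The lemma serves two cases of \<open>B = K \<langle>T\<rangle>\<close>: either \<open>B / K\<close> is cyclic and \<open>T\<close> is a single element
  mapping to a generator, or \<open>K\<close> has finite index and \<open>T\<close> is a transversal.
\<close>
lemma (in group) finitely_generated_over_subgroup:
  assumes B: "subgroup B G" and S: "finite S" "S \<subseteq> B" "generate G S = K"
    and T: "finite T" "T \<subseteq> B" and reduce: "\<And>x. x \<in> B \<Longrightarrow> \<exists>t\<in>generate G T. x \<otimes> t \<in> K"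
  shows "\<exists>S'. finite S' \<and> S' \<subseteq> B \<and> generate G S' = B"
proof (intro exI conjI)
  interpret B: subgroup B G by (rule B)
  have T_carr: "T \<subseteq> carrier G" using T B.subset by blast
  have ST: "subgroup (generate G (S \<union> T)) G"
    using S T B.subset by (intro generate_is_subgroup) blast
  have le: "K \<subseteq> generate G (S \<union> T)" "generate G T \<subseteq> generate G (S \<union> T)"
    using S(3) mono_generate[of S "S \<union> T"] mono_generate[of T "S \<union> T"] by auto
  show "generate G (S \<union> T) = B"
  proof
    show "generate G (S \<union> T) \<subseteq> B"
      using S T B by (intro generate_subgroup_incl) auto
    show "B \<subseteq> generate G (S \<union> T)"
    proof
      fix x assume x: "x \<in> B"
      then obtain t where t: "t \<in> generate G T" "x \<otimes> t \<in> K" using reduce by blast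
      have carr: "x \<in> carrier G" "t \<in> carrier G"
        using x B.subset t(1) generate_in_carrier[OF T_carr] by auto
      have "(x \<otimes> t) \<otimes> inv t \<in> generate G (S \<union> T)"
        by (rule subgroup.m_closed[OF ST], use t le in blast)
          (rule subgroup.m_inv_closed[OF ST], use t le in blast)
      then show "x \<in> generate G (S \<union> T)"
        using carr by (simp add: m_assoc[of x t])
    qed
  qed
qed (use S T in auto)

lemma (in group) finitely_generated_by_finite_index:
  assumes N: "N \<lhd> G" and fin: "finite (carrier (G Mod N))"
    and S: "finite S" "S \<subseteq> carrier G" "generate G S = N"
  shows "finitely_generated_group G"
proof -
  interpret N: normal N G by (rule N)
  define T where "T = (\<lambda>X. SOME t. t \<in> carrier G \<and> N #> t = X) ` carrier (G Mod N)"
  have repr: "\<exists>t\<in>T. t \<in> carrier G \<and> N #> t = N #> x" if "x \<in> carrier G" for x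
  proof -
    have "(SOME t. t \<in> carrier G \<and> N #> t = N #> x) \<in> T"
      using that unfolding T_def carrier_FactGroup by blast
    moreover have "\<exists>t. t \<in> carrier G \<and> N #> t = N #> x" using that by blast
    ultimately show ?thesis
      using someI_ex[of "\<lambda>t. t \<in> carrier G \<and> N #> t = N #> x"] by blast
  qed
  have T: "finite T" "T \<subseteq> carrier G"
  proof -
    show "finite T" using fin by (simp add: T_def)
    have "(SOME t. t \<in> carrier G \<and> N #> t = N #> x) \<in> carrier G" if "x \<in> carrier G" for x
      using someI_ex[of "\<lambda>t. t \<in> carrier G \<and> N #> t = N #> x"] that by blast
    then show "T \<subseteq> carrier G" unfolding T_def carrier_FactGroup by blast
  qed
  have "\<exists>t\<in>generate G T. x \<otimes> t \<in> N" if x: "x \<in> carrier G" for x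
  proof -
    obtain t where t: "t \<in> T" "t \<in> carrier G" "N #> t = N #> x" using repr[OF x] by blast
    then have "x \<in> N #> t" using rcos_self[OF x N.subgroup_axioms] by simp
    then have "x \<otimes> inv t \<in> N" using N.rcos_module t(2) x is_group by blast
    then show ?thesis using generate.inv[OF t(1)] by blast
  qed
  then have "\<exists>S'. finite S' \<and> S' \<subseteq> carrier G \<and> generate G S' = carrier G"
    by (rule finitely_generated_over_subgroup[OF subgroup_self S T])
  then show ?thesis
    by (simp add: finitely_generated_group_def is_group)
qed

text \<open>
  The image of \<open>h\<close> is a subgroup of a cyclic group and hence cyclic. The element \<open>b\<close> is a
  preimage of the least positive power of \<open>c\<close> in the image; division with remainder by that
  exponent shows that \<open>b\<close> generates modulo the kernel. If no positive power of \<open>c\<close> lies in the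
  image, neither does a negative one, and \<open>h\<close> is trivial.
\<close>
lemma (in group_hom) generator_modulo_kernel:
  assumes c: "c \<in> carrier H" and im: "\<And>x. x \<in> carrier G \<Longrightarrow> \<exists>n::int. h x = c [^]\<^bsub>H\<^esub> n"
  shows "\<exists>b\<in>carrier G. \<forall>x\<in>carrier G. \<exists>n::int. h (x \<otimes> b [^] n) = \<one>\<^bsub>H\<^esub>"
proof (cases "\<exists>n::nat. 0 < n \<and> (\<exists>x\<in>carrier G. h x = c [^]\<^bsub>H\<^esub> int n)")
  case True
  define n where "n = (LEAST n::nat. 0 < n \<and> (\<exists>x\<in>carrier G. h x = c [^]\<^bsub>H\<^esub> int n))"
  have "0 < n \<and> (\<exists>x\<in>carrier G. h x = c [^]\<^bsub>H\<^esub> int n)"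
    unfolding n_def by (rule LeastI_ex) (rule True)
  then obtain b where n: "0 < n" and b: "b \<in> carrier G" "h b = c [^]\<^bsub>H\<^esub> int n" by blast
  have "\<exists>k::int. h (x \<otimes> b [^] k) = \<one>\<^bsub>H\<^esub>" if x: "x \<in> carrier G" for x
  proof -
    obtain a :: int where a: "h x = c [^]\<^bsub>H\<^esub> a" using im[OF x] by blast
    define y where "y = x \<otimes> b [^] (- (a div int n))"
    have y: "y \<in> carrier G" using x b by (simp add: y_def)
    have "h y = c [^]\<^bsub>H\<^esub> a \<otimes>\<^bsub>H\<^esub> (c [^]\<^bsub>H\<^esub> int n) [^]\<^bsub>H\<^esub> (- (a div int n))"
      using x b a by (simp add: y_def hom_int_pow del: int_pow_neg)
    also have "\<dots> = c [^]\<^bsub>H\<^esub> (a + int n * (- (a div int n)))"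
      using c by (simp only: H.int_pow_pow H.int_pow_mult)
    also have "a + int n * (- (a div int n)) = a mod int n"
      by (simp add: minus_mult_div_eq_mod)
    also have "a mod int n = int (nat (a mod int n))" using n by simp
    finally have hy: "h y = c [^]\<^bsub>H\<^esub> int (nat (a mod int n))" .
    have "nat (a mod int n) < n" using n by (simp add: nat_less_iff)
    then have "\<not> (0 < nat (a mod int n) \<and>
        (\<exists>x\<in>carrier G. h x = c [^]\<^bsub>H\<^esub> int (nat (a mod int n))))"
      by (subst (asm) n_def) (rule not_less_Least)
    moreover have "\<exists>x\<in>carrier G. h x = c [^]\<^bsub>H\<^esub> int (nat (a mod int n))"
      by (rule bexI[of _ y, OF _ y]) (rule hy)
    ultimately have "\<not> 0 < nat (a mod int n)" by (simp only: simp_thms)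
    then have "nat (a mod int n) = 0" by linarith
    then have "h y = \<one>\<^bsub>H\<^esub>" using hy by simp
    then show ?thesis unfolding y_def by blast
  qed
  then show ?thesis using b(1) by blast
next
  case False
  have "h x = \<one>\<^bsub>H\<^esub>" if x: "x \<in> carrier G" for x
  proof -
    obtain a :: int where a: "h x = c [^]\<^bsub>H\<^esub> a" using im[OF x] by blast
    have "h (inv x) = c [^]\<^bsub>H\<^esub> (- a)"
      using a x c by (simp add: H.int_pow_neg)
    moreover have "\<not> 0 < k" if "y \<in> carrier G" "h y = c [^]\<^bsub>H\<^esub> k" for y and k :: int
    proof
      assume "0 < k"
      then obtain n where "0 < n" "k = int n" by (rule pos_int_cases)
      with that False show False by blast
    qed
    ultimately have "\<not> 0 < - a" "\<not> 0 < a" using x a by blast+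
    then have "a = 0" by simp
    then show ?thesis using a by simp
  qed
  then show ?thesis by auto
qed

text \<open>
  This describes cyclicity of \<open>K / L\<close> by elements and cosets of the ambient group, so that the
  factor group itself can be avoided afterwards.
\<close>
lemma (in group) cyclic_factor_iff:
  assumes K: "subgroup K G" and L: "L \<lhd> G" and LK: "L \<subseteq> K"
  shows "cyclic_group (G\<lparr>carrier := K\<rparr> Mod L) \<longleftrightarrow>
    (\<exists>h\<in>K. \<forall>x\<in>K. \<exists>n::int. L #> x = L #> (h [^] n))"
proof -
  let ?K = "G\<lparr>carrier := K\<rparr>"
  interpret L: normal L ?K by (rule normal_restrict_supergroup[OF K L LK])
  interpret Q: group "?K Mod L" by (rule L.factorgroup_is_group)
  have car: "carrier (?K Mod L) = (\<lambda>x. L #> x) ` K"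
    by (simp add: carrier_FactGroup)
  have pow: "(L #> h) [^]\<^bsub>?K Mod L\<^esub> n = L #> (h [^] n)" if "h \<in> K" for h and n :: int
    using L.FactGroup_int_pow[of h n] that int_pow_consistent[OF K that] by simp
  have closed: "h [^] n \<in> K" if "h \<in> K" for h and n :: int
    using subgroup_int_pow_closed[OF K that] .
  have "cyclic_group (?K Mod L) \<longleftrightarrow>
      (\<exists>h\<in>K. (\<lambda>x. L #> x) ` K = range (\<lambda>n::int. L #> (h [^] n)))"
    by (simp add: Q.cyclic_group car pow cong: bex_cong)
  also have "\<dots> \<longleftrightarrow> (\<exists>h\<in>K. (\<lambda>x. L #> x) ` K \<subseteq> range (\<lambda>n::int. L #> (h [^] n)))"
    using closed by (intro bex_cong refl) blast
  finally show ?thesis by (simp add: image_subset_iff image_iff)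
qed

lemma (in comm_group) generate_insert_factor:
  assumes a: "a \<in> carrier G" and S: "S \<subseteq> carrier G" and x: "x \<in> generate G (insert a S)"
  shows "\<exists>n::int. generate G S #> x = generate G S #> (a [^] n)"
proof -
  have S_sub: "subgroup (generate G S) G" and a_sub: "subgroup (generate G {a}) G"
    using S a by (auto intro: generate_is_subgroup)
  have "subgroup (generate G S <#> generate G {a}) G"
    by (rule mult_subgroups[OF S_sub a_sub])
  moreover have "insert a S \<subseteq> generate G S <#> generate G {a}"
  proof -
    have "\<one> \<otimes> a \<in> generate G S <#> generate G {a}"
      unfolding set_mult_def by (blast intro: generate.one generate.incl)
    moreover have "s \<otimes> \<one> \<in> generate G S <#> generate G {a}" if "s \<in> S" for s
      unfolding set_mult_def using that by (blast intro: generate.one generate.incl)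
    ultimately show ?thesis using a S by (auto simp: subset_iff)
  qed
  ultimately have "x \<in> generate G S <#> generate G {a}"
    using generate_subgroup_incl x by blast
  then obtain s n where s: "s \<in> generate G S" and x_eq: "x = s \<otimes> a [^] (n::int)"
    unfolding set_mult_def generate_pow[OF a] by blast
  have s_carr: "s \<in> carrier G" using s S generate_in_carrier by blast
  have "generate G S #> x = (generate G S #> s) #> (a [^] n)"
    using S_sub s_carr a by (simp add: x_eq coset_mult_assoc subgroup.subset)
  also have "generate G S #> s = generate G S"
    using S_sub s s_carr coset_join2 by blast
  finally show ?thesis by blast
qed

text \<open>
  Adjoining the elements of the group one at a time, in any order, gives a series with cyclic
  factors, and in an abelian group all its terms are normal.
\<close>
lemma (in comm_group) finite_imp_supersoluble:
  assumes "finite (carrier G)"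
  shows "supersoluble_group G"
proof -
  obtain xs where xs: "set xs = carrier G" using finite_list[OF assms] by blast
  define H where "H k = generate G (set (drop k xs))" for k
  have sub: "set (drop k xs) \<subseteq> carrier G" for k
    using xs set_drop_subset by fastforce
  have H_sub: "subgroup (H k) G" for k
    unfolding H_def by (rule generate_is_subgroup[OF sub])
  have H_normal: "H k \<lhd> G" for k
    by (rule subgroup_imp_normal[OF H_sub])
  have top: "H 0 = carrier G"
    using generate_subgroup_incl[OF _ subgroup_self, of "carrier G"] generate.incl[of _ "carrier G" G]
    by (auto simp: H_def xs)
  have bot: "H (length xs) = {\<one>}" by (simp add: H_def generate_empty)
  have factor: "H (Suc k) \<subseteq> H k \<and> cyclic_group (G\<lparr>carrier := H k\<rparr> Mod H (Suc k))"
    if k: "k < length xs" for k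
  proof
    have split: "set (drop k xs) = insert (xs ! k) (set (drop (Suc k) xs))"
      using k by (simp flip: Cons_nth_drop_Suc)
    show dec: "H (Suc k) \<subseteq> H k"
      unfolding H_def split by (rule mono_generate) blast
    have "xs ! k \<in> H k" unfolding H_def split by (blast intro: generate.incl)
    moreover have "\<exists>n::int. H (Suc k) #> x = H (Suc k) #> (xs ! k [^] n)" if "x \<in> H k" for x
      using generate_insert_factor[of "xs ! k" "set (drop (Suc k) xs)" x] that sub[of k]
      unfolding H_def split by simp
    ultimately show "cyclic_group (G\<lparr>carrier := H k\<rparr> Mod H (Suc k))"
      unfolding cyclic_factor_iff[OF H_sub H_normal dec] by blast
  qed
  show ?thesis
    unfolding supersoluble_group_def
    using is_group top bot H_normal factor by blast
qed

text \<open>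
  A filtration with \<open>[F i, G] \<subseteq> F (i + 1)\<close> bounds the lower central series from above.
\<close>
lemma (in group) nilpotent_by_central_filtration:
  assumes F: "\<And>i. subgroup (F i) G" and top: "F 0 = carrier G" and bot: "F n = {\<one>}"
    and comm: "\<And>i x y. x \<in> F i \<Longrightarrow> y \<in> carrier G \<Longrightarrow> x \<otimes> y \<otimes> inv x \<otimes> inv y \<in> F (Suc i)"
  shows "nilpotent_group G"
proof -
  have "lower_central_series G i \<subseteq> F i" for i
  proof (induction i)
    case 0
    then show ?case by (simp add: top)
  next
    case (Suc i)
    show ?case
      unfolding lower_central_series.simps
      by (rule generate_subgroup_incl[OF _ F]) (use comm Suc.IH in blast)
  qed
  moreover have "\<one> \<in> lower_central_series G i" for i
    by (cases i) (auto intro: generate.one)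
  ultimately have "lower_central_series G n = {\<one>}" using bot by blast
  then show ?thesis using is_group by (auto simp: nilpotent_group_def)
qed

section \<open>Groups acting on a cyclic normal series\<close>

text \<open>
  The series is continued by the trivial group beyond \<open>m\<close>, so that congruences modulo
  \<open>H (k + i)\<close> make sense for all \<open>k\<close> and \<open>i\<close>. Invariance is stated as \<open>\<phi> (H k) \<subseteq> H k\<close>;
  equality follows by applying the inverse of \<open>\<phi>\<close>.
\<close>
locale cyclic_series_action = group G + A: group A
  for G :: "('a, 'b) monoid_scheme" (structure) and A :: "('c, 'd) monoid_scheme" +
  fixes act :: "'c \<Rightarrow> 'a \<Rightarrow> 'a" and H :: "nat \<Rightarrow> 'a set" and m :: nat
  assumes act_hom: "\<phi> \<in> carrier A \<Longrightarrow> act \<phi> \<in> hom G G"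
    and act_compose: "\<lbrakk>\<phi> \<in> carrier A; \<psi> \<in> carrier A; x \<in> carrier G\<rbrakk>
      \<Longrightarrow> act (\<phi> \<otimes>\<^bsub>A\<^esub> \<psi>) x = act \<phi> (act \<psi> x)"
    and act_id: "x \<in> carrier G \<Longrightarrow> act \<one>\<^bsub>A\<^esub> x = x"
    and faithful: "\<lbrakk>\<phi> \<in> carrier A; \<And>x. x \<in> carrier G \<Longrightarrow> act \<phi> x = x\<rbrakk> \<Longrightarrow> \<phi> = \<one>\<^bsub>A\<^esub>"
    and series_top: "H 0 = carrier G"
    and series_bot: "m \<le> k \<Longrightarrow> H k = {\<one>}"
    and series_normal: "H k \<lhd> G"
    and series_decreasing: "H (Suc k) \<subseteq> H k"
    and series_cyclic: "\<exists>h\<in>H k. \<forall>x\<in>H k. \<exists>n::int. H (Suc k) #> x = H (Suc k) #> (h [^] n)"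
    and act_series: "\<lbrakk>\<phi> \<in> carrier A; x \<in> H k\<rbrakk> \<Longrightarrow> act \<phi> x \<in> H k"
begin

definition cong :: "nat \<Rightarrow> 'a \<Rightarrow> 'a \<Rightarrow> bool"
  where "cong k x y \<longleftrightarrow> H k #> x = H k #> y"

text \<open>
  A generator of \<open>H k\<close> modulo \<open>H (k + 1)\<close>.
\<close>
definition gen :: "nat \<Rightarrow> 'a"
  where "gen k = (SOME h. h \<in> H k \<and> (\<forall>x\<in>H k. \<exists>n::int. cong (Suc k) x (h [^] n)))"

definition fixing :: "nat \<Rightarrow> 'a set \<Rightarrow> 'c set"
  where "fixing k X = {\<phi> \<in> carrier A. \<forall>x\<in>X. cong k (act \<phi> x) x}"

text \<open>
  The elements of \<open>A\<close> that move every term of the series \<open>i\<close> steps down. In particular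
  \<open>shifting 1\<close> is the stability group of the series.
\<close>
definition shifting :: "nat \<Rightarrow> 'c set"
  where "shifting i = (\<Inter>k. fixing (k + i) (H k))"

lemma series_subgroup: "subgroup (H k) G"
  using series_normal by (rule normal_imp_subgroup)

lemma series_carrier: "x \<in> H k \<Longrightarrow> x \<in> carrier G"
  using series_subgroup by (rule subgroup.mem_carrier)

lemma series_antimono: "k \<le> l \<Longrightarrow> H l \<subseteq> H k"
  using series_decreasing by (rule lift_Suc_antimono_le)

lemma act_closed [simp]: "\<phi> \<in> carrier A \<Longrightarrow> x \<in> carrier G \<Longrightarrow> act \<phi> x \<in> carrier G"
  using act_hom by (auto simp: hom_def)

lemma act_group_hom: "\<phi> \<in> carrier A \<Longrightarrow> group_hom G G (act \<phi>)"
  by unfold_locales (rule act_hom)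

lemma act_mult: "\<lbrakk>\<phi> \<in> carrier A; x \<in> carrier G; y \<in> carrier G\<rbrakk> \<Longrightarrow> act \<phi> (x \<otimes> y) = act \<phi> x \<otimes> act \<phi> y"
  using act_hom by (auto simp: hom_def)

lemma act_m_inv: "\<phi> \<in> carrier A \<Longrightarrow> x \<in> carrier G \<Longrightarrow> act \<phi> (inv x) = inv (act \<phi> x)"
  by (rule group_hom.hom_inv[OF act_group_hom])

lemma act_int_pow: "\<phi> \<in> carrier A \<Longrightarrow> x \<in> carrier G \<Longrightarrow> act \<phi> (x [^] (n::int)) = act \<phi> x [^] n"
  by (rule group_hom.hom_int_pow[OF act_group_hom])

lemma act_inv_act: "\<phi> \<in> carrier A \<Longrightarrow> x \<in> carrier G \<Longrightarrow> act \<phi> (act (inv\<^bsub>A\<^esub> \<phi>) x) = x"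
  "\<phi> \<in> carrier A \<Longrightarrow> x \<in> carrier G \<Longrightarrow> act (inv\<^bsub>A\<^esub> \<phi>) (act \<phi> x) = x"
  by (simp_all flip: act_compose add: act_id)

lemma cong_refl [simp]: "cong k x x"
  by (simp add: cong_def)

lemma cong_sym: "cong k x y \<Longrightarrow> cong k y x"
  by (simp add: cong_def)

lemma cong_trans [trans]: "cong k x y \<Longrightarrow> cong k y z \<Longrightarrow> cong k x z"
  by (simp add: cong_def)

lemma cong_iff_mem:
  assumes "x \<in> carrier G" "y \<in> carrier G"
  shows "cong k x y \<longleftrightarrow> x \<otimes> inv y \<in> H k"
proof -
  have "cong k x y \<longleftrightarrow> x \<in> H k #> y"
    unfolding cong_def
    using assms repr_independence[OF _ _ series_subgroup] repr_independenceD[OF series_subgroup]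
    by metis
  then show ?thesis
    using subgroup.rcos_module[OF series_subgroup is_group] assms by simp
qed

lemma cong_one_iff: "x \<in> carrier G \<Longrightarrow> cong k x \<one> \<longleftrightarrow> x \<in> H k"
  by (simp add: cong_iff_mem)

lemma cong_mult:
  assumes "cong k x x'" "cong k y y'"
    and "x \<in> carrier G" "x' \<in> carrier G" "y \<in> carrier G" "y' \<in> carrier G"
  shows "cong k (x \<otimes> y) (x' \<otimes> y')"
  using assms by (simp add: cong_def flip: normal.rcos_sum[OF series_normal])

lemma cong_int_pow:
  assumes "cong k x y" "x \<in> carrier G" "y \<in> carrier G"
  shows "cong k (x [^] (n::int)) (y [^] n)"
  using assms by (simp add: cong_def flip: normal.FactGroup_int_pow[OF series_normal])

lemma cong_mono: "\<lbrakk>k \<le> l; cong l x y; x \<in> carrier G; y \<in> carrier G\<rbrakk> \<Longrightarrow> cong k x y"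
  using series_antimono by (auto simp: cong_iff_mem)

lemma cong_act:
  assumes "cong k x y" "\<phi> \<in> carrier A" "x \<in> carrier G" "y \<in> carrier G"
  shows "cong k (act \<phi> x) (act \<phi> y)"
  using assms act_series[of \<phi> "x \<otimes> inv y" k] by (simp add: cong_iff_mem act_mult act_m_inv)

lemma cong_bottom: "\<lbrakk>m \<le> k; cong k x y; x \<in> carrier G; y \<in> carrier G\<rbrakk> \<Longrightarrow> x = y"
  by (simp add: cong_iff_mem series_bot inv_solve_right')

lemma gen_mem: "gen k \<in> H k"
  and gen_generates: "x \<in> H k \<Longrightarrow> \<exists>n::int. cong (Suc k) x (gen k [^] n)"
proof -
  have "\<exists>h. h \<in> H k \<and> (\<forall>x\<in>H k. \<exists>n::int. cong (Suc k) x (h [^] n))"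
    using series_cyclic[of k] by (auto simp: cong_def)
  from someI_ex[OF this] show "gen k \<in> H k" "x \<in> H k \<Longrightarrow> \<exists>n::int. cong (Suc k) x (gen k [^] n)"
    unfolding gen_def by blast+
qed

lemma gen_carrier [simp]: "gen k \<in> carrier G"
  using gen_mem by (rule series_carrier)

text \<open>
  Going up the series from the trivial group, each term is generated by the next smaller term
  and one of the elements \<open>gen i\<close>.
\<close>
lemma gens_generate:
  assumes K: "subgroup K G" and gens: "\<And>i. i < m \<Longrightarrow> gen i \<in> K"
  shows "K = carrier G"
proof -
  have "H k \<subseteq> K" if "k \<le> m" for k
    using that
  proof (induction rule: inc_induct)
    case base
    show ?case using series_bot[of m] subgroup.one_closed[OF K] by simp
  next
    case (step k)
    show ?case
    proof
      fix x assume x: "x \<in> H k"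
      then obtain n :: int where "cong (Suc k) x (gen k [^] n)" using gen_generates by blast
      then have "x \<otimes> inv (gen k [^] n) \<in> K"
        using step.IH x series_carrier by (auto simp: cong_iff_mem)
      moreover have "gen k [^] n \<in> K"
        using subgroup_int_pow_closed[OF K] gens step.hyps by simp
      ultimately have "x \<otimes> inv (gen k [^] n) \<otimes> gen k [^] n \<in> K"
        by (rule subgroup.m_closed[OF K])
      then show "x \<in> K" using series_carrier[OF x] by (simp add: m_assoc)
    qed
  qed
  from this[of 0] show ?thesis
    using series_top subgroup.subset[OF K] by auto
qed

lemma fixing_subgroup:
  assumes "X \<subseteq> carrier G"
  shows "subgroup (fixing k X) A"
proof
  show "fixing k X \<subseteq> carrier A" by (auto simp: fixing_def)
  show "\<one>\<^bsub>A\<^esub> \<in> fixing k X"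
    using assms by (auto simp: fixing_def act_id subset_iff)
next
  fix \<phi> \<psi> assume mem: "\<phi> \<in> fixing k X" "\<psi> \<in> fixing k X"
  then have \<phi>: "\<phi> \<in> carrier A" "\<psi> \<in> carrier A" by (auto simp: fixing_def)
  have "cong k (act (\<phi> \<otimes>\<^bsub>A\<^esub> \<psi>) x) x" if x: "x \<in> X" for x
  proof -
    have xG: "x \<in> carrier G" using x assms by blast
    have "cong k (act \<phi> (act \<psi> x)) (act \<phi> x)"
      using x xG mem \<phi> by (intro cong_act) (auto simp: fixing_def)
    also have "cong k (act \<phi> x) x" using x mem by (auto simp: fixing_def)
    finally show ?thesis using \<phi> xG by (simp add: act_compose)
  qed
  then show "\<phi> \<otimes>\<^bsub>A\<^esub> \<psi> \<in> fixing k X" using \<phi> by (simp add: fixing_def)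
next
  fix \<phi> assume mem: "\<phi> \<in> fixing k X"
  then have \<phi>: "\<phi> \<in> carrier A" by (auto simp: fixing_def)
  have "cong k (act (inv\<^bsub>A\<^esub> \<phi>) x) x" if x: "x \<in> X" for x
  proof -
    have xG: "x \<in> carrier G" using x assms by blast
    have "cong k x (act \<phi> x)" using x mem by (auto simp: fixing_def intro: cong_sym)
    then have "cong k (act (inv\<^bsub>A\<^esub> \<phi>) x) (act (inv\<^bsub>A\<^esub> \<phi>) (act \<phi> x))"
      using \<phi> xG by (intro cong_act) auto
    then show ?thesis using \<phi> xG by (simp add: act_inv_act)
  qed
  then show "inv\<^bsub>A\<^esub> \<phi> \<in> fixing k X" using \<phi> by (simp add: fixing_def)
qed

text \<open>
  The elements fixed by \<open>\<phi>\<close> modulo the normal subgroup \<open>H k\<close> form a subgroup of \<open>G\<close>. So it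
  suffices to test the finitely many generators, which later makes the number of extension
  steps finite.
\<close>
lemma fixing_gens: "fixing k (gen ` {..<m}) = fixing k (carrier G)"
proof
  show "fixing k (carrier G) \<subseteq> fixing k (gen ` {..<m})"
    by (auto simp: fixing_def)
  show "fixing k (gen ` {..<m}) \<subseteq> fixing k (carrier G)"
  proof
    fix \<phi> assume mem: "\<phi> \<in> fixing k (gen ` {..<m})"
    then have \<phi>: "\<phi> \<in> carrier A" by (auto simp: fixing_def)
    interpret \<phi>: group_hom G G "act \<phi>" by (rule act_group_hom[OF \<phi>])
    let ?K = "{x \<in> carrier G. cong k (act \<phi> x) x}"
    have "subgroup ?K G"
    proof
      fix x assume "x \<in> ?K"
      then show "inv x \<in> ?K"
        using \<phi> cong_int_pow[of k "act \<phi> x" x "- 1"] by (simp add: int_pow_neg act_m_inv)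
    qed (use \<phi> in \<open>auto simp: act_mult intro: cong_mult\<close>)
    moreover have "gen i \<in> ?K" if "i < m" for i
      using mem that by (auto simp: fixing_def)
    ultimately have "?K = carrier G" by (rule gens_generate)
    then show "\<phi> \<in> fixing k (carrier G)" using \<phi> by (auto simp: fixing_def)
  qed
qed

lemma shifting_subgroup: "subgroup (shifting i) A"
  unfolding shifting_def
  by (intro A.subgroups_Inter) (auto intro!: fixing_subgroup dest: series_carrier)

lemma shiftingI:
  assumes "\<phi> \<in> carrier A" "\<And>k x. x \<in> H k \<Longrightarrow> cong (k + i) (act \<phi> x) x"
  shows "\<phi> \<in> shifting i"
  using assms by (auto simp: shifting_def fixing_def)

lemma shiftingD:
  assumes "\<phi> \<in> shifting i"
  shows "\<phi> \<in> carrier A" "x \<in> H k \<Longrightarrow> cong (k + i) (act \<phi> x) x"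
  using assms by (auto simp: shifting_def fixing_def)

text \<open>
  The commutator measures the failure of \<open>\<phi>\<close> and \<open>\<psi>\<close> to commute: it maps
  \<open>\<psi> (\<phi> y)\<close> to \<open>\<phi> (\<psi> y)\<close>, and every \<open>x \<in> H k\<close> has the form \<open>\<psi> (\<phi> y)\<close> with \<open>y \<in> H k\<close>.
\<close>
lemma commutator_shifting:
  assumes \<phi>: "\<phi> \<in> carrier A" and \<psi>: "\<psi> \<in> carrier A"
    and commute: "\<And>k x. x \<in> H k \<Longrightarrow> cong (k + i) (act \<phi> (act \<psi> x)) (act \<psi> (act \<phi> x))"
  shows "\<phi> \<otimes>\<^bsub>A\<^esub> \<psi> \<otimes>\<^bsub>A\<^esub> inv\<^bsub>A\<^esub> \<phi> \<otimes>\<^bsub>A\<^esub> inv\<^bsub>A\<^esub> \<psi> \<in> shifting i"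
proof (rule shiftingI)
  fix k x assume x: "x \<in> H k"
  have xG: "x \<in> carrier G" using x by (rule series_carrier)
  \<comment> \<open>the element with \<open>\<psi> (\<phi> y) = x\<close>\<close>
  define y where "y = act (inv\<^bsub>A\<^esub> \<phi>) (act (inv\<^bsub>A\<^esub> \<psi>) x)"
  have "y \<in> H k" using x \<phi> \<psi> by (simp add: y_def act_series)
  from commute[OF this]
  show "cong (k + i) (act (\<phi> \<otimes>\<^bsub>A\<^esub> \<psi> \<otimes>\<^bsub>A\<^esub> inv\<^bsub>A\<^esub> \<phi> \<otimes>\<^bsub>A\<^esub> inv\<^bsub>A\<^esub> \<psi>) x) x"
    using \<phi> \<psi> xG by (simp add: act_compose act_inv_act y_def)
qed (use \<phi> \<psi> in simp)

text \<open>
  Write \<open>\<psi> x = x u\<close> and \<open>\<phi> x = v x\<close>, with the displacements on opposite sides of \<open>x\<close>. Modulo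
  \<open>H (k + i + 1)\<close>, \<open>\<phi>\<close> fixes \<open>u \<in> H (k + 1)\<close> and \<open>\<psi>\<close> fixes \<open>v \<in> H (k + i)\<close>, so both composites
  take \<open>x\<close> to \<open>v x u\<close>. With the displacements on the same side, \<open>u\<close> and \<open>v\<close> would have to
  commute modulo \<open>H (k + i + 1)\<close>, which can fail.
\<close>
lemma commutator_increases_shift:
  assumes \<phi>: "\<phi> \<in> shifting i" and \<psi>: "\<psi> \<in> shifting 1"
  shows "\<phi> \<otimes>\<^bsub>A\<^esub> \<psi> \<otimes>\<^bsub>A\<^esub> inv\<^bsub>A\<^esub> \<phi> \<otimes>\<^bsub>A\<^esub> inv\<^bsub>A\<^esub> \<psi> \<in> shifting (Suc i)"
proof (rule commutator_shifting)
  show car: "\<phi> \<in> carrier A" "\<psi> \<in> carrier A" using \<phi> \<psi> by (auto dest: shiftingD)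
  fix k x assume x: "x \<in> H k"
  have xG: "x \<in> carrier G" using x by (rule series_carrier)
  define u where "u = inv x \<otimes> act \<psi> x"
  define v where "v = act \<phi> x \<otimes> inv x"
  have uvG: "u \<in> carrier G" "v \<in> carrier G" using xG car by (simp_all add: u_def v_def)
  have \<psi>x: "act \<psi> x = x \<otimes> u" and \<phi>x: "act \<phi> x = v \<otimes> x"
    using xG car by (simp_all add: u_def v_def m_assoc flip: m_assoc[of x "inv x"])
  have u: "u \<in> H (Suc k)"
    using cong_mult[of "Suc k" "inv x" "inv x" "act \<psi> x" x] shiftingD(2)[OF \<psi> x] xG car
    by (simp add: u_def flip: cong_one_iff)
  have v: "v \<in> H (k + i)"
    using shiftingD(2)[OF \<phi> x] xG car by (simp add: v_def cong_iff_mem)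
  have "cong (k + Suc i) (act \<phi> x \<otimes> act \<phi> u) (act \<phi> x \<otimes> u)"
    using shiftingD(2)[OF \<phi> u] car xG uvG by (intro cong_mult) auto
  also have "act \<phi> x \<otimes> act \<phi> u = act \<phi> (act \<psi> x)"
    using car xG uvG by (simp add: \<psi>x act_mult)
  also have "act \<phi> x \<otimes> u = v \<otimes> act \<psi> x"
    using xG uvG by (simp add: \<phi>x \<psi>x m_assoc)
  also have "cong (k + Suc i) \<dots> (act \<psi> v \<otimes> act \<psi> x)"
    using shiftingD(2)[OF \<psi> v] car xG uvG by (intro cong_mult) (auto intro: cong_sym)
  also have "act \<psi> v \<otimes> act \<psi> x = act \<psi> (act \<phi> x)"
    using car xG uvG by (simp add: \<phi>x act_mult)
  finally show "cong (k + Suc i) (act \<phi> (act \<psi> x)) (act \<psi> (act \<phi> x))" .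
qed

lemma shifting_trivial:
  assumes "m \<le> i"
  shows "shifting i = {\<one>\<^bsub>A\<^esub>}"
proof -
  have "\<phi> = \<one>\<^bsub>A\<^esub>" if "\<phi> \<in> shifting i" for \<phi>
  proof (rule faithful)
    show "\<phi> \<in> carrier A" using that by (rule shiftingD)
    fix x assume x: "x \<in> carrier G"
    then show "act \<phi> x = x"
      using cong_bottom[OF assms] shiftingD(2)[OF that, of x 0] shiftingD(1)[OF that] by (simp add: series_top)
  qed
  then show ?thesis
    using subgroup.one_closed[OF shifting_subgroup] by auto
qed

lemma stability_group_nilpotent: "nilpotent_group (A\<lparr>carrier := shifting 1\<rparr>)"
proof -
  let ?N = "A\<lparr>carrier := shifting 1\<rparr>"
  interpret N: group ?N by (rule A.subgroup_imp_group[OF shifting_subgroup])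
  have anti: "shifting (Suc i) \<subseteq> shifting 1" for i
  proof
    fix \<phi> assume \<phi>: "\<phi> \<in> shifting (Suc i)"
    show "\<phi> \<in> shifting 1"
    proof (rule shiftingI)
      fix k x assume "x \<in> H k"
      then show "cong (k + 1) (act \<phi> x) x"
        using cong_mono[of "k + 1" "k + Suc i"] shiftingD[OF \<phi>] series_carrier by simp
    qed (rule shiftingD(1)[OF \<phi>])
  qed
  show ?thesis
  proof (rule N.nilpotent_by_central_filtration[where F = "\<lambda>i. shifting (Suc i)" and n = m])
    show "subgroup (shifting (Suc i)) ?N" for i
      by (rule A.subgroup_incl[OF shifting_subgroup shifting_subgroup anti])
    show "shifting (Suc m) = {\<one>\<^bsub>?N\<^esub>}" by (simp add: shifting_trivial)
    fix i \<phi> \<psi> assume \<phi>: "\<phi> \<in> shifting (Suc i)" and "\<psi> \<in> carrier ?N"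
    then have \<psi>: "\<psi> \<in> shifting 1" by simp
    have "\<phi> \<in> shifting 1" using \<phi> anti by blast
    then show "\<phi> \<otimes>\<^bsub>?N\<^esub> \<psi> \<otimes>\<^bsub>?N\<^esub> inv\<^bsub>?N\<^esub> \<phi> \<otimes>\<^bsub>?N\<^esub> inv\<^bsub>?N\<^esub> \<psi> \<in> shifting (Suc (Suc i))"
      using commutator_increases_shift[OF \<phi> \<psi>] \<psi>
      by (simp add: A.m_inv_consistent[OF shifting_subgroup] del: One_nat_def)
  qed simp
qed

text \<open>
  On a cyclic factor every endomorphism is a power map \<open>y \<mapsto> y\<^sup>a\<close>, and power maps commute.
\<close>
lemma commutator_in_stability_group:
  assumes \<phi>: "\<phi> \<in> carrier A" and \<psi>: "\<psi> \<in> carrier A"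
  shows "\<phi> \<otimes>\<^bsub>A\<^esub> \<psi> \<otimes>\<^bsub>A\<^esub> inv\<^bsub>A\<^esub> \<phi> \<otimes>\<^bsub>A\<^esub> inv\<^bsub>A\<^esub> \<psi> \<in> shifting 1"
proof (rule commutator_shifting[OF \<phi> \<psi>])
  fix k x assume x: "x \<in> H k"
  let ?h = "gen k"
  have power: "\<exists>a::int. \<forall>n::int. cong (Suc k) (act \<theta> (?h [^] n)) (?h [^] (a * n))"
    if \<theta>: "\<theta> \<in> carrier A" for \<theta>
  proof -
    obtain a :: int where "cong (Suc k) (act \<theta> ?h) (?h [^] a)"
      using gen_generates act_series[OF \<theta> gen_mem] by blast
    then have "cong (Suc k) (act \<theta> ?h [^] n) ((?h [^] a) [^] n)" for n :: int
      using \<theta> by (intro cong_int_pow) auto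
    then show ?thesis using \<theta> by (auto simp: act_int_pow int_pow_pow)
  qed
  obtain a :: int where a: "cong (Suc k) (act \<phi> (?h [^] n)) (?h [^] (a * n))" for n
    using power[OF \<phi>] by blast
  obtain b :: int where b: "cong (Suc k) (act \<psi> (?h [^] n)) (?h [^] (b * n))" for n
    using power[OF \<psi>] by blast
  \<comment> \<open>successive power maps multiply the exponents\<close>
  have twice: "cong (Suc k) (act \<theta> (act \<eta> x)) (?h [^] (c * (d * n)))"
    if "\<theta> \<in> carrier A" "\<eta> \<in> carrier A" "cong (Suc k) x (?h [^] n)"
      "\<And>n. cong (Suc k) (act \<theta> (?h [^] n)) (?h [^] (c * n))"
      "\<And>n. cong (Suc k) (act \<eta> (?h [^] n)) (?h [^] (d * n))"
    for \<theta> \<eta> and n c d :: int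
  proof -
    have "cong (Suc k) (act \<eta> x) (act \<eta> (?h [^] n))"
      using that series_carrier[OF x] by (intro cong_act) auto
    also have "cong (Suc k) (act \<eta> (?h [^] n)) (?h [^] (d * n))" by (rule that)
    finally have "cong (Suc k) (act \<theta> (act \<eta> x)) (act \<theta> (?h [^] (d * n)))"
      using that series_carrier[OF x] by (intro cong_act) auto
    also have "cong (Suc k) (act \<theta> (?h [^] (d * n))) (?h [^] (c * (d * n)))" by (rule that)
    finally show ?thesis .
  qed
  obtain n :: int where n: "cong (Suc k) x (?h [^] n)" using gen_generates[OF x] by blast
  have "cong (Suc k) (act \<phi> (act \<psi> x)) (?h [^] (a * (b * n)))"
    by (rule twice[OF \<phi> \<psi> n a b])
  also have "a * (b * n) = b * (a * n)" by simp
  also have "cong (Suc k) (?h [^] (b * (a * n))) (act \<psi> (act \<phi> x))"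
    by (rule cong_sym[OF twice[OF \<psi> \<phi> n b a]])
  finally show "cong (k + 1) (act \<phi> (act \<psi> x)) (act \<psi> (act \<phi> x))" by simp
qed

text \<open>
  A subgroup that contains all commutators is normal.
\<close>
lemma stability_group_normal: "shifting 1 \<lhd> A"
proof (rule A.normal_invI[OF shifting_subgroup])
  fix \<phi> \<nu> assume \<phi>: "\<phi> \<in> carrier A" and \<nu>: "\<nu> \<in> shifting 1"
  have "\<nu> \<in> carrier A" using \<nu> by (rule shiftingD)
  then have "\<phi> \<otimes>\<^bsub>A\<^esub> \<nu> \<otimes>\<^bsub>A\<^esub> inv\<^bsub>A\<^esub> \<phi> = (\<phi> \<otimes>\<^bsub>A\<^esub> \<nu> \<otimes>\<^bsub>A\<^esub> inv\<^bsub>A\<^esub> \<phi> \<otimes>\<^bsub>A\<^esub> inv\<^bsub>A\<^esub> \<nu>) \<otimes>\<^bsub>A\<^esub> \<nu>"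
    using \<phi> by (simp add: A.m_assoc)
  also have "\<dots> \<in> shifting 1"
    using commutator_in_stability_group[OF \<phi> \<open>\<nu> \<in> carrier A\<close>] \<nu>
    by (rule subgroup.m_closed[OF shifting_subgroup])
  finally show "\<phi> \<otimes>\<^bsub>A\<^esub> \<nu> \<otimes>\<^bsub>A\<^esub> inv\<^bsub>A\<^esub> \<phi> \<in> shifting 1" .
qed

lemma stability_group_quotient_abelian: "comm_group (A Mod shifting 1)"
proof (rule group.group_comm_groupI)
  interpret N: normal "shifting 1" A by (rule stability_group_normal)
  show "group (A Mod shifting 1)" by (rule N.factorgroup_is_group)
  fix X Y assume "X \<in> carrier (A Mod shifting 1)" "Y \<in> carrier (A Mod shifting 1)"
  then obtain \<phi> \<psi> where \<phi>: "\<phi> \<in> carrier A" "X = shifting 1 #>\<^bsub>A\<^esub> \<phi>"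
    and \<psi>: "\<psi> \<in> carrier A" "Y = shifting 1 #>\<^bsub>A\<^esub> \<psi>"
    by (auto simp: carrier_FactGroup)
  have "(\<phi> \<otimes>\<^bsub>A\<^esub> \<psi>) \<otimes>\<^bsub>A\<^esub> inv\<^bsub>A\<^esub> (\<psi> \<otimes>\<^bsub>A\<^esub> \<phi>) \<in> shifting 1"
    using commutator_in_stability_group[OF \<phi>(1) \<psi>(1)] \<phi>(1) \<psi>(1)
    by (simp add: A.inv_mult_group A.m_assoc)
  then have "\<phi> \<otimes>\<^bsub>A\<^esub> \<psi> \<in> shifting 1 #>\<^bsub>A\<^esub> (\<psi> \<otimes>\<^bsub>A\<^esub> \<phi>)"
    using N.rcos_module[OF A.is_group] \<phi>(1) \<psi>(1) by simp
  then have "shifting 1 #>\<^bsub>A\<^esub> (\<psi> \<otimes>\<^bsub>A\<^esub> \<phi>) = shifting 1 #>\<^bsub>A\<^esub> (\<phi> \<otimes>\<^bsub>A\<^esub> \<psi>)"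
    using A.repr_independence[OF _ _ shifting_subgroup] \<phi>(1) \<psi>(1) by simp
  then show "X \<otimes>\<^bsub>A Mod shifting 1\<^esub> Y = Y \<otimes>\<^bsub>A Mod shifting 1\<^esub> X"
    using \<phi> \<psi> by (simp add: N.rcos_sum del: One_nat_def)
qed

text \<open>
  A cyclic group has only finitely many automorphisms. If the \<open>n\<close>-th power of the generator is
  trivial for some \<open>n > 0\<close>, the exponents \<open>0, \<dots>, n - 1\<close> suffice. Otherwise it has infinite order, and
  comparing \<open>\<phi>\<close> with its inverse gives \<open>a * b = 1\<close> for the two exponents, whence \<open>a = 1\<close> or \<open>a = - 1\<close>.
\<close>
lemma finitely_many_gen_images:
  "\<exists>E. finite E \<and> (\<forall>\<phi>\<in>carrier A. \<exists>a\<in>E. cong (Suc k) (act \<phi> (gen k)) (gen k [^] (a::int)))"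
proof -
  let ?h = "gen k"
  have ex: "\<exists>a::int. cong (Suc k) (act \<phi> ?h) (?h [^] a)" if "\<phi> \<in> carrier A" for \<phi>
    using gen_generates act_series[OF that gen_mem] by blast
  show ?thesis
  proof (cases "\<exists>n::int. n > 0 \<and> cong (Suc k) (?h [^] n) \<one>")
    case True
    then obtain n :: int where n: "n > 0" "cong (Suc k) (?h [^] n) \<one>" by blast
    have "\<exists>a\<in>{0..<n}. cong (Suc k) (act \<phi> ?h) (?h [^] a)" if \<phi>: "\<phi> \<in> carrier A" for \<phi>
    proof -
      obtain a :: int where a: "cong (Suc k) (act \<phi> ?h) (?h [^] a)" using ex[OF \<phi>] by blast
      also have "?h [^] a = (?h [^] n) [^] (a div n) \<otimes> ?h [^] (a mod n)"
        by (simp add: int_pow_pow flip: int_pow_mult)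
      also have "cong (Suc k) \<dots> (\<one> \<otimes> ?h [^] (a mod n))"
        using cong_int_pow[OF n(2), of "a div n"] by (intro cong_mult) auto
      finally show ?thesis using n(1) by (intro bexI[of _ "a mod n"]) auto
    qed
    then show ?thesis by (intro exI[of _ "{0..<n}"]) auto
  next
    case False
    have order: "n = 0" if n: "cong (Suc k) (?h [^] n) \<one>" for n :: int
    proof -
      have "cong (Suc k) (?h [^] (- n)) \<one>"
        using cong_int_pow[OF n, of "- 1"] by (simp add: int_pow_pow)
      then show ?thesis using False n by (metis linorder_neqE_linordered_idom neg_0_less_iff_less)
    qed
    have "\<exists>a\<in>{1, - 1 :: int}. cong (Suc k) (act \<phi> ?h) (?h [^] a)" if \<phi>: "\<phi> \<in> carrier A" for \<phi>
    proof -
      obtain a :: int where a: "cong (Suc k) (act \<phi> ?h) (?h [^] a)" using ex[OF \<phi>] by blast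
      obtain b :: int where b: "cong (Suc k) (act (inv\<^bsub>A\<^esub> \<phi>) ?h) (?h [^] b)"
        using ex[of "inv\<^bsub>A\<^esub> \<phi>"] \<phi> by blast
      have "cong (Suc k) (act \<phi> (act (inv\<^bsub>A\<^esub> \<phi>) ?h)) (act \<phi> (?h [^] b))"
        using b \<phi> by (intro cong_act) auto
      also have "cong (Suc k) (act \<phi> (?h [^] b)) ((?h [^] a) [^] b)"
        using a \<phi> by (simp add: act_int_pow cong_int_pow)
      finally have "cong (Suc k) ?h (?h [^] (a * b))"
        using \<phi> by (simp add: act_inv_act int_pow_pow)
      then have "cong (Suc k) (?h \<otimes> ?h [^] (- 1 :: int)) (?h [^] (a * b) \<otimes> ?h [^] (- 1 :: int))"
        by (intro cong_mult) auto
      then have "cong (Suc k) \<one> (?h [^] (a * b - 1))"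
        by (simp add: int_pow_neg int_pow_diff)
      then have "a * b = 1" using order[of "a * b - 1"] cong_sym by fastforce
      then have "a = 1 \<or> a = - 1" using zmult_eq_1_iff by blast
      then show ?thesis using a by blast
    qed
    then show ?thesis by (intro exI[of _ "{1, - 1}"] conjI) (simp, blast)
  qed
qed

text \<open>
  Automorphisms agreeing on the generators of the factors agree on the factors, and so differ by
  an element of the stability group.
\<close>
lemma same_gen_images_same_coset:
  assumes \<phi>: "\<phi> \<in> carrier A" and \<psi>: "\<psi> \<in> carrier A"
    and same: "\<And>k. k < m \<Longrightarrow> cong (Suc k) (act \<phi> (gen k)) (act \<psi> (gen k))"
  shows "shifting 1 #>\<^bsub>A\<^esub> \<phi> = shifting 1 #>\<^bsub>A\<^esub> \<psi>"
proof -
  have eq: "cong (Suc k) (act \<phi> x) (act \<psi> x)" if x: "x \<in> H k" for k x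
  proof (cases "k < m")
    case True
    obtain n :: int where n: "cong (Suc k) x (gen k [^] n)" using gen_generates[OF x] by blast
    have "cong (Suc k) (act \<phi> x) (act \<phi> (gen k [^] n))"
      using n \<phi> series_carrier[OF x] by (intro cong_act) auto
    also have "cong (Suc k) (act \<phi> (gen k [^] n)) (act \<psi> (gen k [^] n))"
      using cong_int_pow[OF same[OF True]] \<phi> \<psi> by (simp add: act_int_pow)
    also have "cong (Suc k) (act \<psi> (gen k [^] n)) (act \<psi> x)"
      using n \<psi> series_carrier[OF x] by (intro cong_act) (auto intro: cong_sym)
    finally show ?thesis .
  next
    case False
    then have "act \<phi> x = \<one>" "act \<psi> x = \<one>"
      using act_series[OF \<phi> x] act_series[OF \<psi> x] series_bot[of k] by auto
    then show ?thesis by simp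
  qed
  have "\<phi> \<otimes>\<^bsub>A\<^esub> inv\<^bsub>A\<^esub> \<psi> \<in> shifting 1"
  proof (rule shiftingI)
    fix k x assume x: "x \<in> H k"
    then show "cong (k + 1) (act (\<phi> \<otimes>\<^bsub>A\<^esub> inv\<^bsub>A\<^esub> \<psi>) x) x"
      using eq[of "act (inv\<^bsub>A\<^esub> \<psi>) x" k] \<phi> \<psi> series_carrier[OF x]
      by (simp add: act_series act_compose act_inv_act)
  qed (use \<phi> \<psi> in simp)
  then have "\<phi> \<in> shifting 1 #>\<^bsub>A\<^esub> \<psi>"
    using subgroup.rcos_module[OF shifting_subgroup A.is_group] \<phi> \<psi> by simp
  then show ?thesis
    using A.repr_independence[OF _ _ shifting_subgroup] \<psi> by metis
qed

text \<open>
  The coset of \<open>\<phi>\<close> is determined by the exponents with which \<open>\<phi>\<close> acts on the \<open>m\<close> factors, and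
  by \<open>finitely_many_gen_images\<close> there are finitely many choices for each of them.
\<close>
lemma stability_group_finite_index: "finite (carrier (A Mod shifting 1))"
proof -
  obtain E where E: "finite (E k)"
    "\<And>\<phi>. \<phi> \<in> carrier A \<Longrightarrow> \<exists>a\<in>E k. cong (Suc k) (act \<phi> (gen k)) (gen k [^] (a::int))" for k
    using finitely_many_gen_images by metis
  define e where "e \<phi> = (\<lambda>k\<in>{..<m}. SOME a. a \<in> E k \<and> cong (Suc k) (act \<phi> (gen k)) (gen k [^] a))"
    for \<phi>
  have e: "e \<phi> k \<in> E k \<and> cong (Suc k) (act \<phi> (gen k)) (gen k [^] e \<phi> k)"
    if "\<phi> \<in> carrier A" "k < m" for \<phi> k
    using someI_ex[of "\<lambda>a. a \<in> E k \<and> cong (Suc k) (act \<phi> (gen k)) (gen k [^] a)"] E(2)[OF that(1), of k] that(2)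
    by (auto simp: e_def)
  have "e ` carrier A \<subseteq> PiE {..<m} E"
    using e by (intro image_subsetI PiE_I) (blast, simp add: e_def)
  then have fin: "finite (e ` carrier A)"
    by (rule finite_subset) (intro finite_PiE finite_lessThan E(1))
  have coset: "shifting 1 #>\<^bsub>A\<^esub> \<phi> = shifting 1 #>\<^bsub>A\<^esub> \<psi>"
    if "\<phi> \<in> carrier A" "\<psi> \<in> carrier A" "e \<phi> = e \<psi>" for \<phi> \<psi>
  proof (rule same_gen_images_same_coset)
    fix k assume "k < m"
    then show "cong (Suc k) (act \<phi> (gen k)) (act \<psi> (gen k))"
      using e[OF that(1)] e[OF that(2)] that(3) cong_sym cong_trans by metis
  qed (use that in auto)
  obtain f where f: "\<And>\<phi>. \<phi> \<in> carrier A \<Longrightarrow> shifting 1 #>\<^bsub>A\<^esub> \<phi> = f (e \<phi>)"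
    using coset function_factors_left_gen[of "\<lambda>\<phi>. \<phi> \<in> carrier A" e "\<lambda>\<phi>. shifting 1 #>\<^bsub>A\<^esub> \<phi>"] by metis
  then have "carrier (A Mod shifting 1) = f ` e ` carrier A"
    by (auto simp: carrier_FactGroup)
  then show ?thesis using fin by simp
qed

text \<open>
  The map \<open>\<phi> \<mapsto> g\<^sup>-\<^sup>1 \<phi>(g)\<close> has values in \<open>H j\<close> because \<open>B\<close> acts trivially on \<open>G / H j\<close>. From
  \<open>g\<^sup>-\<^sup>1 \<phi>(\<psi>(g)) = g\<^sup>-\<^sup>1 \<phi>(g) \<cdot> \<phi>(g\<^sup>-\<^sup>1 \<psi>(g))\<close> and the trivial action on \<open>H j / H (j + 1)\<close> it is
  a homomorphism modulo \<open>H (j + 1)\<close>. Its kernel is \<open>B \<inter> fixing (j + 1) {g}\<close>, and its image lies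
  in a cyclic group, so one more generator suffices for \<open>B\<close>.
\<close>
lemma finitely_generated_fixing_step:
  assumes B: "subgroup B A" and B_stab: "B \<subseteq> shifting 1" and B_fix: "B \<subseteq> fixing j (carrier G)"
    and g: "g \<in> carrier G"
    and S: "finite S" "S \<subseteq> B" "generate A S = B \<inter> fixing (Suc j) {g}"
  shows "\<exists>S. finite S \<and> S \<subseteq> B \<and> generate A S = B"
proof -
  let ?B = "A\<lparr>carrier := B\<rparr>" and ?Q = "G Mod H (Suc j)"
  let ?d = "\<lambda>\<phi>. inv g \<otimes> act \<phi> g"
  interpret HN: normal "H (Suc j)" G by (rule series_normal)
  have BA: "\<phi> \<in> carrier A" if "\<phi> \<in> B" for \<phi> using that B subgroup.mem_carrier by metis
  have d: "?d \<phi> \<in> carrier G" if "\<phi> \<in> B" for \<phi> using BA[OF that] g by simp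
  have d_mem: "?d \<phi> \<in> H j" if \<phi>: "\<phi> \<in> B" for \<phi>
  proof -
    have "cong j (inv g \<otimes> act \<phi> g) (inv g \<otimes> g)"
      using B_fix \<phi> g BA[OF \<phi>] by (intro cong_mult) (auto simp: fixing_def)
    then show ?thesis using d[OF \<phi>] g by (simp add: cong_one_iff)
  qed
  have hom: "group_hom ?B ?Q (\<lambda>\<phi>. H (Suc j) #> ?d \<phi>)"
  proof (intro group_hom.intro group_hom_axioms.intro homI)
    show "group ?B" by (rule A.subgroup_imp_group[OF B])
    show "group ?Q" by (rule HN.factorgroup_is_group)
    show "H (Suc j) #> ?d \<phi> \<in> carrier ?Q" if "\<phi> \<in> carrier ?B" for \<phi>
      using d that by (auto simp: carrier_FactGroup)
    fix \<phi> \<psi> assume "\<phi> \<in> carrier ?B" "\<psi> \<in> carrier ?B"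
    then have \<phi>: "\<phi> \<in> B" and \<psi>: "\<psi> \<in> B" by simp_all
    have "act \<psi> g = g \<otimes> ?d \<psi>" using g BA[OF \<psi>] by (simp flip: m_assoc)
    then have "?d (\<phi> \<otimes>\<^bsub>A\<^esub> \<psi>) = inv g \<otimes> (act \<phi> g \<otimes> act \<phi> (?d \<psi>))"
      using g BA[OF \<phi>] BA[OF \<psi>] d[OF \<psi>] by (simp add: act_compose flip: act_mult)
    also have "\<dots> = ?d \<phi> \<otimes> act \<phi> (?d \<psi>)"
      using g BA[OF \<phi>] d[OF \<psi>] by (simp add: m_assoc)
    also have "cong (Suc j) \<dots> (?d \<phi> \<otimes> ?d \<psi>)"
      using shiftingD(2)[OF subsetD[OF B_stab \<phi>] d_mem[OF \<psi>]] act_closed[OF BA[OF \<phi>] d[OF \<psi>]]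
        d[OF \<phi>] d[OF \<psi>]
      by (intro cong_mult[OF cong_refl]) (simp_all del: m_closed)
    finally show "H (Suc j) #> ?d (\<phi> \<otimes>\<^bsub>?B\<^esub> \<psi>) = (H (Suc j) #> ?d \<phi>) \<otimes>\<^bsub>?Q\<^esub> (H (Suc j) #> ?d \<psi>)"
      using d[OF \<phi>] d[OF \<psi>] by (simp add: cong_def HN.rcos_sum)
  qed
  have "\<exists>b\<in>carrier ?B. \<forall>\<phi>\<in>carrier ?B. \<exists>n::int. H (Suc j) #> ?d (\<phi> \<otimes>\<^bsub>?B\<^esub> b [^]\<^bsub>?B\<^esub> n) = \<one>\<^bsub>?Q\<^esub>"
  proof (rule group_hom.generator_modulo_kernel[OF hom])
    show "H (Suc j) #> gen j \<in> carrier ?Q" by (simp add: carrier_FactGroup)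
    fix \<phi> assume "\<phi> \<in> carrier ?B"
    then show "\<exists>n::int. H (Suc j) #> ?d \<phi> = (H (Suc j) #> gen j) [^]\<^bsub>?Q\<^esub> n"
      using gen_generates[OF d_mem] by (simp add: cong_def HN.FactGroup_int_pow)
  qed
  then obtain b where b: "b \<in> B"
    and reduce: "\<And>\<phi>. \<phi> \<in> B \<Longrightarrow> \<exists>n::int. H (Suc j) #> ?d (\<phi> \<otimes>\<^bsub>A\<^esub> b [^]\<^bsub>A\<^esub> n) = H (Suc j)"
    by (auto simp flip: A.int_pow_consistent[OF B])
  have "\<exists>t\<in>generate A {b}. \<phi> \<otimes>\<^bsub>A\<^esub> t \<in> B \<inter> fixing (Suc j) {g}" if \<phi>: "\<phi> \<in> B" for \<phi>
  proof -
    obtain n :: int where n: "H (Suc j) #> ?d (\<phi> \<otimes>\<^bsub>A\<^esub> b [^]\<^bsub>A\<^esub> n) = H (Suc j)"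
      using reduce[OF \<phi>] by blast
    let ?\<theta> = "\<phi> \<otimes>\<^bsub>A\<^esub> b [^]\<^bsub>A\<^esub> n"
    have \<theta>: "?\<theta> \<in> B"
      using subgroup.m_closed[OF B \<phi> A.subgroup_int_pow_closed[OF B b]] .
    have "cong (Suc j) (?d ?\<theta>) \<one>"
      using n by (simp add: cong_def coset_mult_one HN.subset)
    then have "cong (Suc j) (g \<otimes> ?d ?\<theta>) (g \<otimes> \<one>)"
      using d[OF \<theta>] g by (intro cong_mult) auto
    moreover have "g \<otimes> ?d ?\<theta> = act ?\<theta> g"
      using g BA[OF \<theta>] by (simp flip: m_assoc)
    ultimately have "?\<theta> \<in> fixing (Suc j) {g}"
      using BA[OF \<theta>] g by (simp add: fixing_def)
    moreover have "b [^]\<^bsub>A\<^esub> n \<in> generate A {b}"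
      using A.generate_pow[OF BA[OF b]] by blast
    ultimately show ?thesis using \<theta> by blast
  qed
  then show ?thesis
    using b by (intro A.finitely_generated_over_subgroup[OF B S, of "{b}"]) auto
qed

text \<open>
  Two nested descents: \<open>?N j\<close> is passed to \<open>?N (j + 1)\<close> by imposing, one generator of \<open>G\<close> at a
  time, that this generator is fixed modulo \<open>H (j + 1)\<close>. The groups \<open>?B i\<close> are the intermediate
  stages.
\<close>
lemma stability_group_finitely_generated:
  "\<exists>S. finite S \<and> S \<subseteq> shifting 1 \<and> generate A S = shifting 1"
proof -
  let ?N = "\<lambda>j. shifting 1 \<inter> fixing j (carrier G)"
  let ?fg = "\<lambda>B. \<exists>S. finite S \<and> S \<subseteq> B \<and> generate A S = B"
  have step: "?fg (?N j)" if fg: "?fg (?N (Suc j))" for j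
  proof -
    let ?B = "\<lambda>i. ?N j \<inter> fixing (Suc j) (gen ` {..<i})"
    have sub: "subgroup (?B i) A" for i
      by (intro A.subgroups_Inter_pair shifting_subgroup fixing_subgroup) auto
    have "?B m = ?N (Suc j)"
      using cong_mono[of j "Suc j"] unfolding fixing_gens by (auto simp: fixing_def)
    then have base: "?fg (?B m)" using fg by simp
    have "?fg (?B i)" if "i \<le> m" for i
      using that
    proof (induction rule: inc_induct)
      case base
      show ?case by (rule \<open>?fg (?B m)\<close>)
    next
      case (step i)
      have split: "?B (Suc i) = ?B i \<inter> fixing (Suc j) {gen i}"
        by (auto simp: fixing_def lessThan_Suc)
      from step.IH obtain S
        where S: "finite S" "S \<subseteq> ?B (Suc i)" "generate A S = ?B (Suc i)" by blast
      show ?case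
      proof (rule finitely_generated_fixing_step[OF sub _ _ gen_carrier S(1)])
        show "S \<subseteq> ?B i" using S(2) unfolding split by (rule Int_subset_iff[THEN iffD1, THEN conjunct1])
        show "generate A S = ?B i \<inter> fixing (Suc j) {gen i}" using S(3) unfolding split .
      qed blast+
    qed
    from this[of 0] have "?fg (?B 0)" by blast
    moreover have "?B 0 = ?N j" by (auto simp: fixing_def)
    ultimately show ?thesis by (simp only:)
  qed
  have "?N m = {\<one>\<^bsub>A\<^esub>}"
  proof -
    have "\<phi> = \<one>\<^bsub>A\<^esub>" if "\<phi> \<in> fixing m (carrier G)" for \<phi>
      using that by (auto simp: fixing_def intro!: faithful cong_bottom[of m])
    moreover have "\<one>\<^bsub>A\<^esub> \<in> ?N m"
      using subgroup.one_closed[OF shifting_subgroup] subgroup.one_closed[OF fixing_subgroup] by simp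
    ultimately show ?thesis by blast
  qed
  then have "?fg (?N m)"
    using A.generate_empty by (intro exI[of _ "{}"]) auto
  then have "?fg (?N 0)"
    using step by (rule inc_induct[OF le0])
  moreover have "fixing 0 (carrier G) = carrier A"
    by (auto simp: fixing_def cong_iff_mem series_top)
  then have "?N 0 = shifting 1"
    using subgroup.subset[OF shifting_subgroup] by blast
  ultimately show ?thesis by (simp only:)
qed

lemma acting_group_finitely_generated: "finitely_generated_group A"
proof -
  obtain S where S: "finite S" "S \<subseteq> shifting 1" "generate A S = shifting 1"
    using stability_group_finitely_generated by blast
  have "S \<subseteq> carrier A" using S(2) subgroup.subset[OF shifting_subgroup] by blast
  then show ?thesis
    using A.finitely_generated_by_finite_index[OF stability_group_normal stability_group_finite_index S(1)] S(3)
    by blast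
qed

end

section \<open>Normal automorphisms of a supersoluble group\<close>

lemma (in group) normal_AutoGroup_group: "group (normal_AutoGroup G)"
  unfolding normal_AutoGroup_def
  using AutoGroup group.subgroup_imp_group normal_auto_normal normal_imp_subgroup by blast

text \<open>
  The index \<open>min k m\<close> repeats the trivial last term of the given series for ever.
\<close>
lemma (in group) normal_AutoGroup_acts:
  assumes top: "H 0 = carrier G" and bot: "H m = {\<one>}"
    and norm: "\<And>k. k \<le> m \<Longrightarrow> H k \<lhd> G"
    and dec: "\<And>k. k < m \<Longrightarrow> H (Suc k) \<subseteq> H k"
    and cyc: "\<And>k. k < m \<Longrightarrow> cyclic_group (G\<lparr>carrier := H k\<rparr> Mod H (Suc k))"
  shows "cyclic_series_action G (normal_AutoGroup G) (\<lambda>\<phi>. \<phi>) (\<lambda>k. H (min k m)) m"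
proof -
  let ?A = "normal_AutoGroup G"
  have A: "\<phi> \<in> hom G G" "\<phi> \<in> Bij (carrier G)" "\<And>N. N \<lhd> G \<Longrightarrow> \<phi> ` N = N"
    if "\<phi> \<in> carrier ?A" for \<phi>
    using that by (auto simp: normal_AutoGroup_def normal_auto_def auto_def)
  have one: "\<one>\<^bsub>?A\<^esub> = (\<lambda>x\<in>carrier G. x)"
    by (simp add: normal_AutoGroup_def AutoGroup_def BijGroup_def)
  have mult: "\<phi> \<otimes>\<^bsub>?A\<^esub> \<psi> = compose (carrier G) \<phi> \<psi>"
    if "\<phi> \<in> carrier ?A" "\<psi> \<in> carrier ?A" for \<phi> \<psi>
    using A(2)[OF that(1)] A(2)[OF that(2)]
    by (simp add: normal_AutoGroup_def AutoGroup_def BijGroup_def)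
  show ?thesis
  proof (intro cyclic_series_action.intro cyclic_series_action_axioms.intro)
    show "group G" by (rule is_group)
    show "group ?A" by (rule normal_AutoGroup_group)
    show "\<phi> \<in> hom G G" if "\<phi> \<in> carrier ?A" for \<phi> using A that by blast
    show "(\<phi> \<otimes>\<^bsub>?A\<^esub> \<psi>) x = \<phi> (\<psi> x)"
      if "\<phi> \<in> carrier ?A" "\<psi> \<in> carrier ?A" "x \<in> carrier G" for \<phi> \<psi> x
      using that by (simp add: mult compose_def)
    show "\<one>\<^bsub>?A\<^esub> x = x" if "x \<in> carrier G" for x using that by (simp add: one)
    show "\<phi> = \<one>\<^bsub>?A\<^esub>" if "\<phi> \<in> carrier ?A" "\<And>x. x \<in> carrier G \<Longrightarrow> \<phi> x = x" for \<phi>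
      unfolding one using that Bij_imp_extensional[OF A(2)[OF that(1)]]
      by (intro extensionalityI[of _ "carrier G"]) auto
    show "H (min 0 m) = carrier G" using top by simp
    show "H (min k m) = {\<one>}" if "m \<le> k" for k using that bot by (simp add: min_absorb2)
    show "H (min k m) \<lhd> G" for k by (rule norm) simp
    show "H (min (Suc k) m) \<subseteq> H (min k m)" for k
      using dec[of k] by (cases "k < m") (auto simp: min_def)
    show "\<exists>h\<in>H (min k m). \<forall>x\<in>H (min k m). \<exists>n::int. H (min (Suc k) m) #> x = H (min (Suc k) m) #> (h [^] n)"
      for k
    proof (cases "k < m")
      case True
      then show ?thesis
        using cyc[OF True] cyclic_factor_iff[OF normal_imp_subgroup[OF norm[of k]] norm[of "Suc k"] dec[OF True]]
        by (simp add: min_def)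
    next
      case False
      then show ?thesis using bot by (auto simp: min_def intro: exI[of _ 0])
    qed
    show "\<phi> x \<in> H (min k m)" if "\<phi> \<in> carrier ?A" "x \<in> H (min k m)" for \<phi> x k
      using A(3)[OF that(1) norm, of "min k m"] that(2) by auto
  qed
qed

theorem theorem3:
  fixes G :: "('a, 'b) monoid_scheme"
  assumes "supersoluble_group G"
  shows "finitely_generated_group (normal_AutoGroup G) \<and>
    (\<exists>N. N \<lhd> normal_AutoGroup G \<and>
         nilpotent_group ((normal_AutoGroup G)\<lparr>carrier := N\<rparr>) \<and>
         finite (carrier (normal_AutoGroup G Mod N)) \<and>
         supersoluble_group (normal_AutoGroup G Mod N))"
proof -
  interpret G: group G using assms by (simp add: supersoluble_group_def)
  obtain m :: nat and H where H: "H 0 = carrier G" "H m = {\<one>\<^bsub>G\<^esub>}"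
    "\<forall>k\<le>m. H k \<lhd> G"
    "\<forall>k<m. H (Suc k) \<subseteq> H k \<and> cyclic_group (G\<lparr>carrier := H k\<rparr> Mod H (Suc k))"
    using assms unfolding supersoluble_group_def by blast
  interpret cyclic_series_action G "normal_AutoGroup G" "\<lambda>\<phi>. \<phi>" "\<lambda>k. H (min k m)" m
    by (rule G.normal_AutoGroup_acts) (use H in auto)
  have "supersoluble_group (normal_AutoGroup G Mod shifting 1)"
    using stability_group_quotient_abelian stability_group_finite_index by (rule comm_group.finite_imp_supersoluble)
  then show ?thesis
    using acting_group_finitely_generated stability_group_normal stability_group_nilpotent stability_group_finite_index
    by blast
qed

end
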